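(* Using a parallel mechanical matrix-vector processor (MVP), the Boolean product $AB$ of two Boolean $n\times n$ matrices $A$ and $B$ (with $(AB)[i,j]=\bigvee_{k=1}^n(A[i,k]\wedge B[k,j])$) can be computed in $O(n)$ parallel steps, each using $O(n)$ operations.
   Context: A matrix-vector processor (MVP) has an input $n\times n$ Boolean array whose columns can be active or not active, an input $n$-dimensional Boolean vector, and an output $n$-dimensional Boolean vector. A parallel mechanical MVP is one in which: deactivating all columns can be done in one parallel step and activating exactly the columns $j$ with input-vector coordinate $1$ can be done in one parallel step, each using $O(n)$ operations; setting all $n$ output coordinates (the $i$-th to $1$ iff row $i$ of the input array has a $1$ in an active column, else $0$) is done in one parallel step using $O(n)$ operations; resetting the output vector is one parallel step with $O(n)$ operations; reading an input vector is one parallel step with $O(n)$ operations; and reading an $n\times n$ input matrix into the input array takes $O(n)$ parallel steps each using $O(n)$ operations. *)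

theory Defs
  imports Complex_Main "HOL-Library.Landau_Symbols" "Jordan_Normal_Form.Matrix"
begin

definition bool_mat_mult :: "nat \<Rightarrow> bool mat \<Rightarrow> bool mat \<Rightarrow> bool mat" where
  "bool_mat_mult n A B = mat n n (\<lambda>(i, j). \<exists>k<n. A $$ (i, k) \<and> B $$ (k, j))"

record mvp_state =
  input_array :: "bool mat"
  active_columns :: "nat set"
  input_vector :: "bool vec"
  output_vector :: "bool vec"

definition mvp_states :: "nat \<Rightarrow> mvp_state set" where
  "mvp_states n = {s. input_array s \<in> carrier_mat n n \<and> active_columns s \<subseteq> {..<n} \<and>
     input_vector s \<in> carrier_vec n \<and> output_vector s \<in> carrier_vec n}"

text \<open>
  The type parameters are the vectors and matrices that can be read: actual Boolean data for the
  device itself, references to the operands for a program (see below).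
\<close>

datatype ('v, 'm) mvp_instr =
    Deactivate_Columns
  | Activate_Columns
  | Set_Output
  | Reset_Output
  | Read_Vector 'v
  | Read_Matrix 'm

type_synonym mvp_op = "(bool vec, bool mat) mvp_instr"

definition mvp_ops :: "nat \<Rightarrow> mvp_op set" where
  "mvp_ops n = {x. set1_mvp_instr x \<subseteq> carrier_vec n \<and> set2_mvp_instr x \<subseteq> carrier_mat n n}"

fun exec_op :: "nat \<Rightarrow> mvp_op \<Rightarrow> mvp_state \<Rightarrow> mvp_state" where
  "exec_op n Deactivate_Columns s = s\<lparr>active_columns := {}\<rparr>"
| "exec_op n Activate_Columns s = s\<lparr>active_columns := {j. j < n \<and> input_vector s $ j}\<rparr>"
| "exec_op n Set_Output s =
     s\<lparr>output_vector := vec n (\<lambda>i. \<exists>j\<in>active_columns s. input_array s $$ (i, j))\<rparr>"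
| "exec_op n Reset_Output s = s\<lparr>output_vector := vec n (\<lambda>i. False)\<rparr>"
| "exec_op n (Read_Vector v) s = s\<lparr>input_vector := v\<rparr>"
| "exec_op n (Read_Matrix M) s = s\<lparr>input_array := M\<rparr>"

definition run :: "nat \<Rightarrow> mvp_op list \<Rightarrow> mvp_state \<Rightarrow> mvp_state" where
  "run n xs s = fold (exec_op n) xs s"

text \<open>
  A cost assignment describes the physical realisation of a device: \<open>cost n s x\<close> lists, for the
  consecutive parallel steps in which the device of size \<open>n\<close> carries out \<open>x\<close> in state \<open>s\<close>, the number
  of operations used in each of these steps.
\<close>

type_synonym mvp_cost = "nat \<Rightarrow> mvp_state \<Rightarrow> mvp_op \<Rightarrow> nat list"

fun run_cost :: "mvp_cost \<Rightarrow> nat \<Rightarrow> mvp_op list \<Rightarrow> mvp_state \<Rightarrow> nat list" where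
  "run_cost cost n [] s = []"
| "run_cost cost n (x # xs) s = cost n s x @ run_cost cost n xs (exec_op n x s)"

definition parallel_mechanical_mvp :: "mvp_cost \<Rightarrow> bool" where
  "parallel_mechanical_mvp cost \<longleftrightarrow>
     (\<exists>r w :: nat \<Rightarrow> nat.
        (\<lambda>n. real (r n)) \<in> O(\<lambda>n. real n) \<and> (\<lambda>n. real (w n)) \<in> O(\<lambda>n. real n) \<and>
        (\<forall>n. \<forall>s\<in>mvp_states n. \<forall>x\<in>mvp_ops n.
           (case x of Read_Matrix M \<Rightarrow> length (cost n s x) \<le> r n
                    | _ \<Rightarrow> length (cost n s x) = 1) \<and>
           (\<forall>k\<in>set (cost n s x). k \<le> w n)))"

text \<open>
  Programs for matrix multiplication may depend on the size but not on the entries of the operands: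
  all they can do with the operands is to have one of them, or a row or column of one of them, read
  by the device.
\<close>

datatype operand = Left_Operand | Right_Operand

datatype vector_ref = Row_Of operand nat | Column_Of operand nat

type_synonym mvp_program = "(vector_ref, operand) mvp_instr list"

fun fetch_matrix :: "bool mat \<Rightarrow> bool mat \<Rightarrow> operand \<Rightarrow> bool mat" where
  "fetch_matrix A B Left_Operand = A"
| "fetch_matrix A B Right_Operand = B"

fun fetch_vector :: "bool mat \<Rightarrow> bool mat \<Rightarrow> vector_ref \<Rightarrow> bool vec" where
  "fetch_vector A B (Row_Of X i) = row (fetch_matrix A B X) i"
| "fetch_vector A B (Column_Of X j) = col (fetch_matrix A B X) j"

definition well_formed_program :: "nat \<Rightarrow> mvp_program \<Rightarrow> bool" where
  "well_formed_program n p \<longleftrightarrow>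
     (\<forall>x\<in>set p. \<forall>v\<in>set1_mvp_instr x. case v of Row_Of X i \<Rightarrow> i < n | Column_Of X j \<Rightarrow> j < n)"

definition instantiate :: "bool mat \<Rightarrow> bool mat \<Rightarrow> mvp_program \<Rightarrow> mvp_op list" where
  "instantiate A B p = map (map_mvp_instr (fetch_vector A B) (fetch_matrix A B)) p"

text \<open>
  The device has only one output vector, so a matrix is output column by column: column \<open>j\<close> of
  the result is the content of the output vector after the first \<open>t j\<close> instructions. Like the
  program, the readout times \<open>t\<close> must not depend on the operands.
\<close>

definition result_matrix ::
  "nat \<Rightarrow> (nat \<Rightarrow> nat) \<Rightarrow> mvp_op list \<Rightarrow> mvp_state \<Rightarrow> bool mat" where
  "result_matrix n t xs s =
     mat_of_cols n (map (\<lambda>j. output_vector (run n (take (t j) xs) s)) [0..<n])"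

end

theory Submission
  imports Defs
begin

text \<open>
  Column \<open>j\<close> of \<open>AB\<close> is the product of \<open>A\<close> with column \<open>j\<close> of \<open>B\<close>. Hence \<open>A\<close> is read into the array
  once, in \<open>O(n)\<close> parallel steps, and each of the \<open>n\<close> columns of \<open>B\<close> then costs only three further
  parallel steps: read it as the input vector, activate the columns it selects, set the output.
\<close>

text \<open>The cost bounds of a device are only available for states in
  \<open>mvp_states n\<close>; this invariance carries them along a whole run.\<close>

lemma exec_op_mvp_states:
  assumes "s \<in> mvp_states n" and "x \<in> mvp_ops n"
  shows "exec_op n x s \<in> mvp_states n"
  using assms by (cases x) (auto simp: mvp_states_def mvp_ops_def)

lemma run_append: "run n (xs @ ys) s = run n ys (run n xs s)"
  by (simp add: run_def)

lemma instantiate_append: "instantiate A B (p @ q) = instantiate A B p @ instantiate A B q"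
  by (simp add: instantiate_def)

lemma take_instantiate: "take k (instantiate A B p) = instantiate A B (take k p)"
  by (simp add: instantiate_def take_map)

lemma fetch_matrix_carrier:
  "A \<in> carrier_mat n n \<Longrightarrow> B \<in> carrier_mat n n \<Longrightarrow> fetch_matrix A B X \<in> carrier_mat n n"
  by (cases X) auto

lemma fetch_vector_carrier:
  assumes "A \<in> carrier_mat n n" and "B \<in> carrier_mat n n"
  shows "fetch_vector A B v \<in> carrier_vec n"
proof (cases v)
  case (Row_Of X i)
  then show ?thesis
    using carrier_matD(2)[OF fetch_matrix_carrier[OF assms, of X]] by (simp add: carrier_vecI)
next
  case (Column_Of X j)
  then show ?thesis
    using carrier_matD(1)[OF fetch_matrix_carrier[OF assms, of X]] by (simp add: carrier_vecI)
qed

lemma instantiate_mvp_ops: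
  assumes "A \<in> carrier_mat n n" and "B \<in> carrier_mat n n"
  shows "set (instantiate A B p) \<subseteq> mvp_ops n"
  using fetch_matrix_carrier[OF assms] fetch_vector_carrier[OF assms]
  by (auto simp: instantiate_def mvp_ops_def mvp_instr.set_map)

text \<open>The actual cost may depend on the current state, but \<open>f\<close> sees only the
  instruction. Generalising over \<open>s\<close> in the induction thus gives a bound that can be
  summed without knowing the intermediate states.\<close>

lemma length_run_cost_le:
  assumes "\<And>s x. s \<in> mvp_states n \<Longrightarrow> x \<in> mvp_ops n \<Longrightarrow> length (cost n s x) \<le> f x"
    and "s \<in> mvp_states n" and "set xs \<subseteq> mvp_ops n"
  shows "length (run_cost cost n xs s) \<le> (\<Sum>x\<leftarrow>xs. f x)"
  using assms(2,3)
proof (induction xs arbitrary: s)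
  case (Cons x xs)
  then show ?case
    using assms(1)[of s x] Cons.IH[of "exec_op n x s"] exec_op_mvp_states[of s n x]
    by (simp add: add_mono)
qed simp

lemma run_cost_le:
  assumes "\<And>s x k. s \<in> mvp_states n \<Longrightarrow> x \<in> mvp_ops n \<Longrightarrow> k \<in> set (cost n s x) \<Longrightarrow> k \<le> w"
    and "s \<in> mvp_states n" and "set xs \<subseteq> mvp_ops n" and "k \<in> set (run_cost cost n xs s)"
  shows "k \<le> w"
  using assms(2-4)
proof (induction xs arbitrary: s)
  case (Cons x xs)
  then consider "k \<in> set (cost n s x)" | "k \<in> set (run_cost cost n xs (exec_op n x s))" by auto
  then show ?case
  proof cases
    case 1
    then show ?thesis using Cons.prems assms(1)[of s x k] by simp
  next
    case 2
    then show ?thesis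
      using Cons.prems Cons.IH[of "exec_op n x s"] exec_op_mvp_states[of s n x] by simp
  qed
qed simp

text \<open>\<open>Activate_Columns\<close> replaces the active set and \<open>Set_Output\<close>
  the whole output vector, so nothing from an earlier column survives.\<close>

definition column_program :: "nat \<Rightarrow> mvp_program" where
  "column_program j = [Read_Vector (Column_Of Right_Operand j), Activate_Columns, Set_Output]"

text \<open>The number \<open>m\<close> of columns is kept apart from the device size, so that the
  prefixes at which columns are read out are again of this form and induction on \<open>m\<close> is
  possible.\<close>

definition product_program :: "nat \<Rightarrow> mvp_program" where
  "product_program m = Read_Matrix Left_Operand # concat (map column_program [0..<m])"

lemma product_program_Suc: "product_program (Suc m) = product_program m @ column_program m"
  by (simp add: product_program_def)

lemma length_product_program: "length (product_program m) = 3 * m + 1"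
  by (induction m)
    (simp_all add: product_program_Suc, simp_all add: product_program_def column_program_def)

text \<open>One instruction loads the matrix and each column takes three, so the cut falls exactly
  between two column blocks.\<close>

lemma take_product_program:
  assumes "m \<le> n"
  shows "take (3 * m + 1) (product_program n) = product_program m"
  using assms
proof (induction n rule: dec_induct)
  case base
  show ?case by (simp add: length_product_program)
next
  case (step n)
  then show ?case by (simp add: product_program_Suc length_product_program)
qed

lemma well_formed_product_program: "well_formed_program n (product_program n)"
  by (auto simp: well_formed_program_def product_program_def column_program_def)

lemma run_column_program:
  "run n (instantiate A B (column_program j)) s =
     s\<lparr>input_vector := col B j, active_columns := {k. k < n \<and> col B j $ k},
       output_vector := vec n (\<lambda>i. \<exists>k<n. col B j $ k \<and> input_array s $$ (i, k))\<rparr>"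
  by (auto simp: run_def instantiate_def column_program_def)

text \<open>Only the initial \<open>Read_Matrix\<close> writes the array, so \<open>A\<close> is
  still there for every later column.\<close>

lemma input_array_run_product_program:
  "input_array (run n (instantiate A B (product_program m)) s) = A"
proof (induction m)
  case 0
  show ?case by (simp add: run_def instantiate_def product_program_def)
next
  case (Suc m)
  then show ?case
    by (simp add: product_program_Suc instantiate_append run_append run_column_program)
qed

lemma output_vector_run_product_program:
  "output_vector (run n (instantiate A B (product_program (Suc j))) s) =
     vec n (\<lambda>i. \<exists>k<n. col B j $ k \<and> A $$ (i, k))"
  by (simp add: product_program_Suc instantiate_append run_append run_column_program
      input_array_run_product_program)

text \<open>The readout time \<open>3 * Suc j + 1\<close> is the moment just after the
  \<open>Set_Output\<close> for column \<open>j\<close>, before the next column overwrites the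
  output.\<close>

lemma result_matrix_product_program:
  assumes "B \<in> carrier_mat n n"
  shows "result_matrix n (\<lambda>j. 3 * Suc j + 1) (instantiate A B (product_program n)) s =
    bool_mat_mult n A B"
proof (rule eq_matI)
  fix i j
  assume "i < dim_row (bool_mat_mult n A B)" and "j < dim_col (bool_mat_mult n A B)"
  then have ij: "i < n" "j < n" by (simp_all add: bool_mat_mult_def)
  have "take (3 * Suc j + 1) (instantiate A B (product_program n)) =
      instantiate A B (product_program (Suc j))"
    using ij by (simp only: take_instantiate take_product_program Suc_leI)
  then have "result_matrix n (\<lambda>j. 3 * Suc j + 1) (instantiate A B (product_program n)) s $$ (i, j) \<longleftrightarrow>
      output_vector (run n (instantiate A B (product_program (Suc j))) s) $ i"
    \<comment> \<open>Deleting \<open>mult_Suc_right\<close> keeps \<open>3 * Suc j\<close> in the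
      shape used by the fact about \<open>take\<close>.\<close>
    using ij by (simp add: result_matrix_def mat_of_cols_index del: mult_Suc_right)
  then show "result_matrix n (\<lambda>j. 3 * Suc j + 1) (instantiate A B (product_program n)) s $$ (i, j) =
      bool_mat_mult n A B $$ (i, j)"
    using ij assms
    by (auto simp: output_vector_run_product_program bool_mat_mult_def)
qed (simp_all add: result_matrix_def bool_mat_mult_def)

lemma sum_list_product_program:
  "(\<Sum>x\<leftarrow>instantiate A B (product_program m). case x of Read_Matrix M \<Rightarrow> r | _ \<Rightarrow> 1) = r + 3 * m"
proof (induction m)
  case 0
  show ?case by (simp add: instantiate_def product_program_def)
next
  case (Suc m)
  then show ?case
    by (simp add: product_program_Suc instantiate_append)
      (simp add: instantiate_def column_program_def)
qed

theorem theorem2: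
  fixes cost :: mvp_cost
  assumes "parallel_mechanical_mvp cost"
  shows "\<exists>(prog :: nat \<Rightarrow> mvp_program) (t :: nat \<Rightarrow> nat \<Rightarrow> nat) (T :: nat \<Rightarrow> nat) (W :: nat \<Rightarrow> nat).
    (\<lambda>n. real (T n)) \<in> O(\<lambda>n. real n) \<and> (\<lambda>n. real (W n)) \<in> O(\<lambda>n. real n) \<and>
    (\<forall>n. well_formed_program n (prog n) \<and> (\<forall>j<n. t n j \<le> length (prog n)) \<and>
      (\<forall>A \<in> carrier_mat n n. \<forall>B \<in> carrier_mat n n. \<forall>s \<in> mvp_states n.
        result_matrix n (t n) (instantiate A B (prog n)) s = bool_mat_mult n A B \<and>
        length (run_cost cost n (instantiate A B (prog n)) s) \<le> T n \<and>
        (\<forall>k \<in> set (run_cost cost n (instantiate A B (prog n)) s). k \<le> W n)))"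
proof -
  obtain r w :: "nat \<Rightarrow> nat" where
    r: "(\<lambda>n. real (r n)) \<in> O(\<lambda>n. real n)" and w: "(\<lambda>n. real (w n)) \<in> O(\<lambda>n. real n)" and
    cost: "\<And>n s x. s \<in> mvp_states n \<Longrightarrow> x \<in> mvp_ops n \<Longrightarrow>
      (case x of Read_Matrix M \<Rightarrow> length (cost n s x) \<le> r n | _ \<Rightarrow> length (cost n s x) = 1) \<and>
      (\<forall>k\<in>set (cost n s x). k \<le> w n)"
    using assms unfolding parallel_mechanical_mvp_def by blast
  have steps: "length (cost n s x) \<le> (case x of Read_Matrix M \<Rightarrow> r n | _ \<Rightarrow> 1)"
    if "s \<in> mvp_states n" "x \<in> mvp_ops n" for n s x
    using cost[OF that] by (cases x) auto
  have T: "(\<lambda>n. real (r n + 3 * n)) \<in> O(\<lambda>n. real n)"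
    using r by (simp add: sum_in_bigo)
  have length_le: "length (run_cost cost n (instantiate A B (product_program n)) s) \<le> r n + 3 * n"
    if "A \<in> carrier_mat n n" "B \<in> carrier_mat n n" "s \<in> mvp_states n" for n A B s
    \<comment> \<open>The closed form is turned back into the sum that
      \<open>length_run_cost_le\<close> bounds by; \<open>A\<close> and \<open>B\<close> are given
      explicitly because \<open>r n + 3 * n\<close> does not determine them.\<close>
    unfolding sum_list_product_program[where A = A and B = B, symmetric]
    by (rule length_run_cost_le[OF steps that(3) instantiate_mvp_ops[OF that(1,2)]])
  have work_le: "k \<le> w n"
    if "A \<in> carrier_mat n n" "B \<in> carrier_mat n n" "s \<in> mvp_states n"
      "k \<in> set (run_cost cost n (instantiate A B (product_program n)) s)" for n A B s k
    using run_cost_le[where cost = cost, OF _ that(3) instantiate_mvp_ops[OF that(1,2)] that(4)]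
      cost by blast
  show ?thesis
    \<comment> \<open>For \<open>j < n\<close> the readout time is at most \<open>3 * n + 1\<close>,
      the length of the program.\<close>
    by (rule exI[of _ product_program], rule exI[of _ "\<lambda>n j. 3 * Suc j + 1"],
        rule exI[of _ "\<lambda>n. r n + 3 * n"], rule exI[of _ w])
      (intro conjI allI ballI impI T w well_formed_product_program result_matrix_product_program
        length_le, auto simp: length_product_program intro: work_le)
qed

end
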